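(* Let $p$ be an odd rational prime such that $\mathbb{Z}[\zeta_p]$ is a UFD, $K=\mathbb{Q}(\zeta_p)$, where $\zeta_p$ is the primitive $p$-th root of unity such that $1-\zeta_p$ is positive. Let $\alpha\in\mathbb{Z}[\zeta_p]$ be an odd norm-perfect integer and for $j\in\{1,\dots,p-1\}$ let $P_j=\{\psi\in\mathbb{P}_K^+:\ \psi\equiv j\pmod{1-\zeta_p},\ \psi\mid\alpha\}$. Then $$\alpha=\varepsilon\,\psi_0^k\prod_{j=1}^{p-1}\ \prod_{\psi_j\in P_j\setminus\{\psi_0\}}\psi_j^{e_{\psi_j}}$$ where: each $\psi$ with a subscript is an odd positive prime; $\varepsilon$ is a unit; for $j\ne 1$, $e_{\psi_j}\not\equiv -1\pmod t$ where $t$ is the order of $j$ in $(\mathbb{Z}/p\mathbb{Z})^*$; $e_{\psi_1}\not\equiv -1\pmod p$; and if $\psi_0\in P_j$ with $j\ne 1$ then $k\equiv -1\pmod t$ with $t$ the order of $j$ in $(\mathbb{Z}/p\mathbb{Z})^*$, while if $\psi_0\in P_1$ then $k\equiv -1\pmod p$.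
   Context: $N_K$ is the norm of $K/\mathbb{Q}$; $\mathbb{Z}[\zeta_p]/(1-\zeta_p)\cong\mathbb{Z}/p\mathbb{Z}$. Positive primes $\mathbb{P}_K^+$: a prime $\psi$ of $\mathbb{Z}[\zeta_p]$ is positive if its argument (angle with the positive real axis) is smaller than that of any of its associates and, if $p\ne 3$, its absolute value in $\mathbb{C}$ is the smallest (among associates) such that $|\psi|\ge N_K(\psi)^{1/(p-1)}$; this selects one representative per associate class. For nonzero $\alpha=\varepsilon\prod\pi_j^{e_j}$ with $\varepsilon$ a unit and distinct $\pi_j\in\mathbb{P}_K^+$, $\sigma_K(\alpha)=\prod\frac{\pi_j^{e_j+1}-1}{\pi_j-1}$. $\alpha$ is odd if $(1-\zeta_p)\nmid\alpha$. $\alpha$ is norm-perfect if $N_K(\sigma_K(\alpha))=N_K(1-\zeta_p)N_K(\alpha)=pN_K(\alpha)$.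
   Formalization: For p ≥ 7 the smallest absolute value need not exist (never for 1−ζ_p), so the positive primes are any system of one prime per associate class with minimal argument and, if p ≠ 3, |ψ| ≥ N_K(ψ)^{1/(p−1)}, containing all primes meeting the literal rule and 1−ζ_p. *)

theory Defs
  imports
    "HOL-Analysis.Complex_Transcendental"
    "HOL-Algebra.Generated_Fields"
    "HOL-Algebra.Generated_Rings"
    "HOL-Algebra.Ring_Divisibility"
    "HOL-Number_Theory.Number_Theory"
begin

definition complex_ring :: "complex ring" where
  "complex_ring = \<lparr>carrier = UNIV, mult = (*), one = 1, zero = 0, add = (+)\<rparr>"

definition primitive_root_of_unity :: "nat \<Rightarrow> complex \<Rightarrow> bool" where
  "primitive_root_of_unity n \<zeta> \<longleftrightarrow> \<zeta> ^ n = 1 \<and> (\<forall>k. 0 < k \<and> k < n \<longrightarrow> \<zeta> ^ k \<noteq> 1)"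

text \<open>The field \<open>\<rat>(\<zeta>)\<close> and the ring \<open>\<int>[\<zeta>]\<close>, both as substructures of the complex numbers.\<close>

definition Q_adj :: "complex \<Rightarrow> complex ring" where
  "Q_adj \<zeta> = complex_ring\<lparr>carrier := generate_field complex_ring {\<zeta>}\<rparr>"

definition Z_adj :: "complex \<Rightarrow> complex ring" where
  "Z_adj \<zeta> = complex_ring\<lparr>carrier := generate_ring complex_ring {\<zeta>}\<rparr>"

text \<open>The absolute norm of \<open>\<rat>(\<zeta>)\<close>: the product of the images under all complex embeddings.
  Embeddings are made extensional so that each one is counted once.\<close>

definition embeddings :: "complex \<Rightarrow> (complex \<Rightarrow> complex) set" where
  "embeddings \<zeta> = ring_hom (Q_adj \<zeta>) complex_ring \<inter> extensional (carrier (Q_adj \<zeta>))"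

definition field_norm :: "complex \<Rightarrow> complex \<Rightarrow> complex" where
  "field_norm \<zeta> x = (\<Prod>\<phi>\<in>embeddings \<zeta>. \<phi> x)"

definition prime_elements :: "complex \<Rightarrow> complex set" where
  "prime_elements \<zeta> = {\<psi> \<in> carrier (Z_adj \<zeta>). ring_prime\<^bsub>Z_adj \<zeta>\<^esub> \<psi>}"

definition associates :: "complex \<Rightarrow> complex \<Rightarrow> complex set" where
  "associates \<zeta> \<psi> = {\<phi> \<in> carrier (Z_adj \<zeta>). \<phi> \<sim>\<^bsub>Z_adj \<zeta>\<^esub> \<psi>}"

text \<open>Arguments are taken in \<open>[0, 2\<pi>)\<close>. The comparison of arguments is not strict, because
  multiplication by a positive real unit does not change the argument. The norm is a nonnegative
  rational number here, and associates have the same norm.\<close>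

definition min_arg :: "complex \<Rightarrow> complex \<Rightarrow> bool" where
  "min_arg \<zeta> \<psi> \<longleftrightarrow> (\<forall>\<phi>\<in>associates \<zeta> \<psi>. Arg2pi \<psi> \<le> Arg2pi \<phi>)"

definition norm_bound :: "nat \<Rightarrow> complex \<Rightarrow> complex \<Rightarrow> bool" where
  "norm_bound p \<zeta> \<psi> \<longleftrightarrow> Re (field_norm \<zeta> \<psi>) powr (1 / (real p - 1)) \<le> cmod \<psi>"

definition min_abs :: "nat \<Rightarrow> complex \<Rightarrow> complex \<Rightarrow> bool" where
  "min_abs p \<zeta> \<psi> \<longleftrightarrow> norm_bound p \<zeta> \<psi> \<and>
     (\<forall>\<phi>\<in>associates \<zeta> \<psi>. norm_bound p \<zeta> \<phi> \<longrightarrow> cmod \<psi> \<le> cmod \<phi>)"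

definition positive_prime :: "nat \<Rightarrow> complex \<Rightarrow> complex \<Rightarrow> bool" where
  "positive_prime p \<zeta> \<psi> \<longleftrightarrow>
     \<psi> \<in> prime_elements \<zeta> \<and> min_arg \<zeta> \<psi> \<and> (p \<noteq> 3 \<longrightarrow> min_abs p \<zeta> \<psi>)"

text \<open>For \<open>p = 3\<close> and \<open>p = 5\<close> the predicate above selects exactly one prime from every class of
  associates. For \<open>p \<ge> 7\<close> the unit group has rank at least 2, the absolute values of the
  associates of \<open>\<psi>\<close> are dense in the positive reals, and the minimum in \<open>min_abs\<close> need not be
  attained; in particular \<open>1 - \<zeta>\<close> then never satisfies it. So \<open>P\<close> is taken to be a
  system of representatives: all the conditions hold for its members, except that the absolute
  value is required to be the smallest one only in those classes where a smallest one exists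
  (the member of \<open>P\<close> in such a class is the prime satisfying \<open>positive_prime\<close>). As soon as the
  predicate does select one prime per class, \<open>P\<close> is the set of primes satisfying it.\<close>

definition positive_primes :: "nat \<Rightarrow> complex \<Rightarrow> complex set \<Rightarrow> bool" where
  "positive_primes p \<zeta> P \<longleftrightarrow>
     P \<subseteq> prime_elements \<zeta> \<and>
     (\<forall>\<psi>\<in>P. min_arg \<zeta> \<psi> \<and> (p \<noteq> 3 \<longrightarrow> norm_bound p \<zeta> \<psi>)) \<and>
     {\<psi>. positive_prime p \<zeta> \<psi>} \<subseteq> P \<and>
     (\<forall>\<pi>\<in>prime_elements \<zeta>. \<exists>!\<psi>. \<psi> \<in> P \<and> \<psi> \<in> associates \<zeta> \<pi>)"

lemma positive_primes_unique:
  assumes "\<And>\<pi>. \<pi> \<in> prime_elements \<zeta> \<Longrightarrow> \<exists>!\<psi>. positive_prime p \<zeta> \<psi> \<and> \<psi> \<in> associates \<zeta> \<pi>"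
  shows "positive_primes p \<zeta> P \<longleftrightarrow> P = {\<psi>. positive_prime p \<zeta> \<psi>}"
proof
  assume P: "positive_primes p \<zeta> P"
  have refl: "\<psi> \<in> associates \<zeta> \<psi>" if "\<psi> \<in> prime_elements \<zeta>" for \<psi>
    using that generate_ring.one[of complex_ring "{\<zeta>}"]
    by (auto simp: prime_elements_def associates_def associated_def factor_def Z_adj_def
        complex_ring_def intro!: bexI[of _ 1])
  have "P \<subseteq> {\<psi>. positive_prime p \<zeta> \<psi>}"
  proof
    fix \<psi> assume \<psi>: "\<psi> \<in> P"
    hence pr: "\<psi> \<in> prime_elements \<zeta>" using P by (auto simp: positive_primes_def)
    obtain \<phi> where \<phi>: "positive_prime p \<zeta> \<phi>" "\<phi> \<in> associates \<zeta> \<psi>"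
      using assms[OF pr] by blast
    have "\<phi> \<in> P" using P \<phi>(1) by (auto simp: positive_primes_def)
    moreover have "\<exists>!\<theta>. \<theta> \<in> P \<and> \<theta> \<in> associates \<zeta> \<psi>"
      using P pr by (simp add: positive_primes_def)
    ultimately have "\<phi> = \<psi>" using \<phi>(2) \<psi> refl[OF pr] by blast
    thus "\<psi> \<in> {\<psi>. positive_prime p \<zeta> \<psi>}" using \<phi>(1) by simp
  qed
  thus "P = {\<psi>. positive_prime p \<zeta> \<psi>}" using P by (auto simp: positive_primes_def)
next
  assume "P = {\<psi>. positive_prime p \<zeta> \<psi>}"
  thus "positive_primes p \<zeta> P" using assms
    by (auto simp: positive_primes_def positive_prime_def min_abs_def)
qed

text \<open>In \<open>prime_decomposition\<close>, \<open>S\<close> is the finite set of the \<open>\<pi>\<^sub>j\<close> and \<open>e\<close> gives the exponents;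
  an exponent 0 contributes the factor 1 to \<open>sigma\<close>.\<close>

definition prime_decomposition ::
  "complex \<Rightarrow> complex set \<Rightarrow> complex \<Rightarrow> complex set \<Rightarrow> (complex \<Rightarrow> nat) \<Rightarrow> bool" where
  "prime_decomposition \<zeta> P \<alpha> S e \<longleftrightarrow> finite S \<and> S \<subseteq> P \<and>
     (\<exists>\<epsilon>\<in>Units (Z_adj \<zeta>). \<alpha> = \<epsilon> * (\<Prod>\<pi>\<in>S. \<pi> ^ e \<pi>))"

definition sigma :: "complex \<Rightarrow> complex set \<Rightarrow> complex \<Rightarrow> complex" where
  "sigma \<zeta> P \<alpha> = (THE s. \<exists>S e. prime_decomposition \<zeta> P \<alpha> S e \<and>
     s = (\<Prod>\<pi>\<in>S. (\<pi> ^ (e \<pi> + 1) - 1) / (\<pi> - 1)))"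

definition odd_element :: "complex \<Rightarrow> complex \<Rightarrow> bool" where
  "odd_element \<zeta> \<alpha> \<longleftrightarrow> \<not> (1 - \<zeta>) divides\<^bsub>Z_adj \<zeta>\<^esub> \<alpha>"

definition norm_perfect :: "complex \<Rightarrow> complex set \<Rightarrow> complex \<Rightarrow> bool" where
  "norm_perfect \<zeta> P \<alpha> \<longleftrightarrow>
     field_norm \<zeta> (sigma \<zeta> P \<alpha>) = field_norm \<zeta> (1 - \<zeta>) * field_norm \<zeta> \<alpha>"

definition prime_divisors_mod ::
  "complex \<Rightarrow> complex set \<Rightarrow> complex \<Rightarrow> nat \<Rightarrow> complex set" where
  "prime_divisors_mod \<zeta> P \<alpha> j =
     {\<psi> \<in> P. (1 - \<zeta>) divides\<^bsub>Z_adj \<zeta>\<^esub> (\<psi> - of_nat j) \<and> \<psi> divides\<^bsub>Z_adj \<zeta>\<^esub> \<alpha>}"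

end

theory Submission
  imports Defs
begin

text \<open>Put \<open>\<lambda> = 1 - \<zeta>\<close>. Every embedding sends \<open>\<zeta>\<close> to a power of itself, so it maps \<open>\<int>[\<zeta>]\<close> to itself and
  acts trivially modulo \<open>\<lambda>\<close>; as \<open>\<lambda>\<close> is prime, \<open>\<lambda>\<close> divides \<open>N(x)\<close> iff it divides \<open>x\<close>. Comparing both
  sides of \<open>N(\<sigma>(\<alpha>)) = N(\<lambda>) N(\<alpha>)\<close>, where \<open>\<lambda>\<close> does not divide \<open>\<alpha>\<close>, shows that \<open>\<lambda>\<close> divides
  \<open>\<sigma>(\<alpha>)\<close> exactly once.
  Hence exactly one of the factors \<open>1 + \<psi> + \<dots> + \<psi>\<^sup>e\<close> of \<open>\<sigma>(\<alpha>)\<close> is divisible by \<open>\<lambda>\<close>. For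
  \<open>\<psi> \<equiv> j\<close> this factor is \<open>\<equiv> 1 + j + \<dots> + j\<^sup>e\<close>, and an integer is divisible by \<open>\<lambda>\<close> iff it is
  divisible by \<open>p\<close>.\<close>

section \<open>The ring and the field generated by a complex number\<close>

lemma complex_ring_simps [simp]:
  "carrier complex_ring = UNIV" "mult complex_ring = (*)" "one complex_ring = 1"
  "zero complex_ring = 0" "add complex_ring = (+)"
  by (simp_all add: complex_ring_def)

lemma Z_adj_simps [simp]:
  "mult (Z_adj \<zeta>) = (*)" "one (Z_adj \<zeta>) = 1" "zero (Z_adj \<zeta>) = 0" "add (Z_adj \<zeta>) = (+)"
  by (simp_all add: Z_adj_def)

lemma Q_adj_simps [simp]:
  "mult (Q_adj \<zeta>) = (*)" "one (Q_adj \<zeta>) = 1" "zero (Q_adj \<zeta>) = 0" "add (Q_adj \<zeta>) = (+)"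
  by (simp_all add: Q_adj_def)

lemma cring_complex_ring: "cring complex_ring"
proof (rule cringI)
  show "abelian_group complex_ring"
    by (rule abelian_groupI) (auto simp: algebra_simps intro: exI[of _ "- x" for x :: complex])
  show "comm_monoid complex_ring"
    by (rule comm_monoidI) (auto simp: algebra_simps)
qed (auto simp: algebra_simps)

lemma a_inv_complex_ring [simp]: "a_inv complex_ring x = - x"
proof -
  interpret cring complex_ring by (rule cring_complex_ring)
  show ?thesis using minus_equality[of "- x" x] by simp
qed

lemma m_inv_complex_ring [simp]: "x \<noteq> 0 \<Longrightarrow> m_inv complex_ring x = inverse x"
proof -
  interpret cring complex_ring by (rule cring_complex_ring)
  show "x \<noteq> 0 \<Longrightarrow> m_inv complex_ring x = inverse x"
    using comm_inv_char[of x "inverse x"] by simp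
qed

text \<open>Induction over \<open>generate_ring\<close>, restated with the ordinary operations on
  complex numbers. The step cases keep membership of the arguments in the ring, because embeddings
  respect sums and products only on the field.\<close>

lemma Z_adj_induct [consumes 1, case_names one gen uminus add mult]:
  assumes "x \<in> carrier (Z_adj \<zeta>)" "Q 1" "Q \<zeta>"
    and "\<And>x. x \<in> carrier (Z_adj \<zeta>) \<Longrightarrow> Q x \<Longrightarrow> Q (- x)"
    and "\<And>x y. x \<in> carrier (Z_adj \<zeta>) \<Longrightarrow> y \<in> carrier (Z_adj \<zeta>) \<Longrightarrow> Q x \<Longrightarrow> Q y \<Longrightarrow> Q (x + y)"
    and "\<And>x y. x \<in> carrier (Z_adj \<zeta>) \<Longrightarrow> y \<in> carrier (Z_adj \<zeta>) \<Longrightarrow> Q x \<Longrightarrow> Q y \<Longrightarrow> Q (x * y)"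
  shows "Q x"
proof -
  have "x \<in> generate_ring complex_ring {\<zeta>}" using assms(1) by (simp add: Z_adj_def)
  thus ?thesis
    by (induction rule: generate_ring.induct) (use assms in \<open>auto simp: Z_adj_def\<close>)
qed

text \<open>The field version has one more case, the inverse of a nonzero element; it serves to show
  that an embedding is determined by the image of \<zeta>.\<close>

lemma Q_adj_induct [consumes 1, case_names one gen uminus inverse add mult]:
  assumes "x \<in> carrier (Q_adj \<zeta>)" "Q 1" "Q \<zeta>"
    and "\<And>x. x \<in> carrier (Q_adj \<zeta>) \<Longrightarrow> Q x \<Longrightarrow> Q (- x)"
    and "\<And>x. x \<in> carrier (Q_adj \<zeta>) \<Longrightarrow> x \<noteq> 0 \<Longrightarrow> Q x \<Longrightarrow> Q (inverse x)"
    and "\<And>x y. x \<in> carrier (Q_adj \<zeta>) \<Longrightarrow> y \<in> carrier (Q_adj \<zeta>) \<Longrightarrow> Q x \<Longrightarrow> Q y \<Longrightarrow> Q (x + y)"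
    and "\<And>x y. x \<in> carrier (Q_adj \<zeta>) \<Longrightarrow> y \<in> carrier (Q_adj \<zeta>) \<Longrightarrow> Q x \<Longrightarrow> Q y \<Longrightarrow> Q (x * y)"
  shows "Q x"
proof -
  have "x \<in> generate_field complex_ring {\<zeta>}" using assms(1) by (simp add: Q_adj_def)
  thus ?thesis
    by (induction rule: generate_field.induct) (use assms in \<open>auto simp: Q_adj_def\<close>)
qed

lemma Z_adj_one [simp, intro]: "1 \<in> carrier (Z_adj \<zeta>)"
  using generate_ring.one[of complex_ring "{\<zeta>}"] by (simp add: Z_adj_def)

lemma Z_adj_gen [simp, intro]: "\<zeta> \<in> carrier (Z_adj \<zeta>)"
  using generate_ring.incl[of \<zeta> "{\<zeta>}" complex_ring] by (simp add: Z_adj_def)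

lemma Z_adj_uminus [intro]: "x \<in> carrier (Z_adj \<zeta>) \<Longrightarrow> - x \<in> carrier (Z_adj \<zeta>)"
  using generate_ring.a_inv[of x complex_ring "{\<zeta>}"] by (simp add: Z_adj_def)

lemma Z_adj_add [intro]:
  "x \<in> carrier (Z_adj \<zeta>) \<Longrightarrow> y \<in> carrier (Z_adj \<zeta>) \<Longrightarrow> x + y \<in> carrier (Z_adj \<zeta>)"
  using generate_ring.eng_add[of x complex_ring "{\<zeta>}" y] by (simp add: Z_adj_def)

lemma Z_adj_mult [intro]:
  "x \<in> carrier (Z_adj \<zeta>) \<Longrightarrow> y \<in> carrier (Z_adj \<zeta>) \<Longrightarrow> x * y \<in> carrier (Z_adj \<zeta>)"
  using generate_ring.eng_mult[of x complex_ring "{\<zeta>}" y] by (simp add: Z_adj_def)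

lemma Z_adj_diff [intro]:
  "x \<in> carrier (Z_adj \<zeta>) \<Longrightarrow> y \<in> carrier (Z_adj \<zeta>) \<Longrightarrow> x - y \<in> carrier (Z_adj \<zeta>)"
  using Z_adj_add[OF _ Z_adj_uminus] by fastforce

lemma Z_adj_zero [simp, intro]: "0 \<in> carrier (Z_adj \<zeta>)"
  using Z_adj_diff[OF Z_adj_one Z_adj_one] by simp

lemma Z_adj_power [intro]: "x \<in> carrier (Z_adj \<zeta>) \<Longrightarrow> x ^ n \<in> carrier (Z_adj \<zeta>)"
  by (induction n) auto

lemma Z_adj_sum [intro]:
  "(\<And>i. i \<in> A \<Longrightarrow> f i \<in> carrier (Z_adj \<zeta>)) \<Longrightarrow> sum f A \<in> carrier (Z_adj \<zeta>)"
  by (induction A rule: infinite_finite_induct) auto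

lemma Z_adj_prod [intro]:
  "(\<And>i. i \<in> A \<Longrightarrow> f i \<in> carrier (Z_adj \<zeta>)) \<Longrightarrow> prod f A \<in> carrier (Z_adj \<zeta>)"
  by (induction A rule: infinite_finite_induct) auto

lemma Z_adj_of_nat [simp, intro]: "of_nat n \<in> carrier (Z_adj \<zeta>)"
  by (induction n) auto

lemma Z_adj_of_int [simp, intro]: "of_int n \<in> carrier (Z_adj \<zeta>)"
  by (cases n rule: int_diff_cases) auto

lemma Z_adj_subset_Q_adj: "carrier (Z_adj \<zeta>) \<subseteq> carrier (Q_adj \<zeta>)"
proof
  fix x assume "x \<in> carrier (Z_adj \<zeta>)"
  thus "x \<in> carrier (Q_adj \<zeta>)"
    using generate_field.one[of complex_ring "{\<zeta>}"] generate_field.incl[of \<zeta> "{\<zeta>}" complex_ring]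
      generate_field.a_inv[of _ complex_ring "{\<zeta>}"]
      generate_field.eng_add[of _ complex_ring "{\<zeta>}"]
      generate_field.eng_mult[of _ complex_ring "{\<zeta>}"]
    by (induction rule: Z_adj_induct) (auto simp: Q_adj_def)
qed

lemma Q_adj_uminus: "x \<in> carrier (Q_adj \<zeta>) \<Longrightarrow> - x \<in> carrier (Q_adj \<zeta>)"
  using generate_field.a_inv[of x complex_ring "{\<zeta>}"] by (simp add: Q_adj_def)

lemma Q_adj_inverse: "x \<in> carrier (Q_adj \<zeta>) \<Longrightarrow> x \<noteq> 0 \<Longrightarrow> inverse x \<in> carrier (Q_adj \<zeta>)"
  using generate_field.m_inv[of x complex_ring "{\<zeta>}"] by (simp add: Q_adj_def)

section \<open>Divisibility, congruences and units in \<open>\<int>[\<zeta>]\<close>\<close>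

lemma Z_adj_divides_iff:
  "a divides\<^bsub>Z_adj \<zeta>\<^esub> b \<longleftrightarrow> (\<exists>c\<in>carrier (Z_adj \<zeta>). b = a * c)"
  by (simp add: factor_def)

lemma Z_adj_divides_add:
  assumes "a divides\<^bsub>Z_adj \<zeta>\<^esub> b" "a divides\<^bsub>Z_adj \<zeta>\<^esub> c"
  shows "a divides\<^bsub>Z_adj \<zeta>\<^esub> (b + c)"
  using assms Z_adj_add unfolding Z_adj_divides_iff by (metis distrib_left)

lemma Z_adj_divides_uminus:
  assumes "a divides\<^bsub>Z_adj \<zeta>\<^esub> b"
  shows "a divides\<^bsub>Z_adj \<zeta>\<^esub> (- b)"
  using assms Z_adj_uminus unfolding Z_adj_divides_iff by (metis mult_minus_right)

lemma Z_adj_divides_diff: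
  assumes "a divides\<^bsub>Z_adj \<zeta>\<^esub> b" "a divides\<^bsub>Z_adj \<zeta>\<^esub> c"
  shows "a divides\<^bsub>Z_adj \<zeta>\<^esub> (b - c)"
  using Z_adj_divides_add[OF assms(1) Z_adj_divides_uminus[OF assms(2)]] by simp

lemma Z_adj_divides_cong:
  assumes "a divides\<^bsub>Z_adj \<zeta>\<^esub> (x - y)"
  shows "a divides\<^bsub>Z_adj \<zeta>\<^esub> x \<longleftrightarrow> a divides\<^bsub>Z_adj \<zeta>\<^esub> y"
  using Z_adj_divides_add[OF assms, of y] Z_adj_divides_diff[OF _ assms, of x] by auto

lemma Z_adj_divides_multL:
  assumes "a divides\<^bsub>Z_adj \<zeta>\<^esub> b" "c \<in> carrier (Z_adj \<zeta>)"
  shows "a divides\<^bsub>Z_adj \<zeta>\<^esub> (b * c)"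
  using assms Z_adj_mult unfolding Z_adj_divides_iff by (metis mult.assoc)

lemma Z_adj_divides_trans:
  assumes "a divides\<^bsub>Z_adj \<zeta>\<^esub> b" "b divides\<^bsub>Z_adj \<zeta>\<^esub> c"
  shows "a divides\<^bsub>Z_adj \<zeta>\<^esub> c"
proof -
  obtain d where "d \<in> carrier (Z_adj \<zeta>)" "c = b * d"
    using assms(2) unfolding Z_adj_divides_iff by blast
  thus ?thesis using Z_adj_divides_multL[OF assms(1)] by simp
qed

lemma Z_adj_divides_zero: "a divides\<^bsub>Z_adj \<zeta>\<^esub> 0"
  by (auto simp: Z_adj_divides_iff intro!: bexI[of _ 0])

lemma Z_adj_divides_sum:
  "(\<And>i. i \<in> A \<Longrightarrow> a divides\<^bsub>Z_adj \<zeta>\<^esub> f i) \<Longrightarrow> a divides\<^bsub>Z_adj \<zeta>\<^esub> sum f A"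
  by (induction A rule: infinite_finite_induct) (auto intro: Z_adj_divides_zero Z_adj_divides_add)

lemma Z_adj_divides_mult_cong:
  assumes "a divides\<^bsub>Z_adj \<zeta>\<^esub> (x - x')" "a divides\<^bsub>Z_adj \<zeta>\<^esub> (y - y')"
    and "y \<in> carrier (Z_adj \<zeta>)" "x' \<in> carrier (Z_adj \<zeta>)"
  shows "a divides\<^bsub>Z_adj \<zeta>\<^esub> (x * y - x' * y')"
proof -
  have "x * y - x' * y' = (x - x') * y + (y - y') * x'" by (simp add: algebra_simps)
  thus ?thesis using assms by (auto intro!: Z_adj_divides_add Z_adj_divides_multL)
qed

lemma Z_adj_divides_power_cong:
  assumes "a divides\<^bsub>Z_adj \<zeta>\<^esub> (x - y)" "x \<in> carrier (Z_adj \<zeta>)" "y \<in> carrier (Z_adj \<zeta>)"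
  shows "a divides\<^bsub>Z_adj \<zeta>\<^esub> (x ^ n - y ^ n)"
proof (induction n)
  case (Suc n)
  show ?case
    using Z_adj_divides_mult_cong[OF assms(1) Suc Z_adj_power[OF assms(2)] assms(3)]
    by simp
qed (simp add: Z_adj_divides_zero)

lemma Z_adj_Units_iff:
  "u \<in> Units (Z_adj \<zeta>) \<longleftrightarrow> u \<in> carrier (Z_adj \<zeta>) \<and> (\<exists>v\<in>carrier (Z_adj \<zeta>). u * v = 1)"
  by (auto simp: Units_def mult.commute)

lemma Z_adj_Units_mult:
  assumes "u \<in> Units (Z_adj \<zeta>)" "v \<in> Units (Z_adj \<zeta>)"
  shows "u * v \<in> Units (Z_adj \<zeta>)"
proof -
  obtain u' v' where "u' \<in> carrier (Z_adj \<zeta>)" "u * u' = 1" "v' \<in> carrier (Z_adj \<zeta>)" "v * v' = 1"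
    using assms by (auto simp: Z_adj_Units_iff)
  moreover from this have "u * v * (u' * v') = 1" by (simp add: algebra_simps)
  ultimately show ?thesis using assms unfolding Z_adj_Units_iff by blast
qed

section \<open>Prime elements and prime decompositions\<close>

lemma prime_elementsD:
  assumes "\<pi> \<in> prime_elements \<zeta>"
  shows "\<pi> \<in> carrier (Z_adj \<zeta>)" "\<pi> \<noteq> 0" "\<pi> \<notin> Units (Z_adj \<zeta>)" "\<pi> \<noteq> 1"
    and "\<And>a b. a \<in> carrier (Z_adj \<zeta>) \<Longrightarrow> b \<in> carrier (Z_adj \<zeta>) \<Longrightarrow>
      \<pi> divides\<^bsub>Z_adj \<zeta>\<^esub> (a * b) \<Longrightarrow> \<pi> divides\<^bsub>Z_adj \<zeta>\<^esub> a \<or> \<pi> divides\<^bsub>Z_adj \<zeta>\<^esub> b"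
  using assms by (auto simp: prime_elements_def ring_prime_def Divisibility.prime_def Z_adj_Units_iff)

lemma prime_element_not_divides_one:
  assumes "\<pi> \<in> prime_elements \<zeta>"
  shows "\<not> \<pi> divides\<^bsub>Z_adj \<zeta>\<^esub> 1"
  using prime_elementsD[OF assms] by (metis Z_adj_Units_iff Z_adj_divides_iff)

lemma prime_element_divides_prod:
  assumes "\<pi> \<in> prime_elements \<zeta>" "\<And>i. i \<in> A \<Longrightarrow> f i \<in> carrier (Z_adj \<zeta>)"
    and "\<pi> divides\<^bsub>Z_adj \<zeta>\<^esub> prod f A"
  shows "\<exists>i\<in>A. \<pi> divides\<^bsub>Z_adj \<zeta>\<^esub> f i"
  using assms(2,3)
proof (induction A rule: infinite_finite_induct)
  case (insert x A)
  thus ?case using prime_elementsD(5)[OF assms(1), of "f x" "prod f A"] by auto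
qed (use prime_element_not_divides_one[OF assms(1)] in auto)

lemma prime_element_divides_power:
  assumes "\<pi> \<in> prime_elements \<zeta>" "x \<in> carrier (Z_adj \<zeta>)" "\<pi> divides\<^bsub>Z_adj \<zeta>\<^esub> x ^ n"
  shows "\<pi> divides\<^bsub>Z_adj \<zeta>\<^esub> x"
  using prime_element_divides_prod[OF assms(1), of "{..<n}" "\<lambda>_. x"] assms(2,3) by auto

text \<open>Write \<open>\<rho> = \<pi> * c\<close>. Since \<rho> is prime and divides this product,
  it divides \<pi> or \<open>c\<close>; in the second case cancelling \<rho> would make \<pi> a
  unit.\<close>

lemma prime_elements_divides_imp_associated:
  assumes "\<pi> \<in> prime_elements \<zeta>" "\<rho> \<in> prime_elements \<zeta>" "\<pi> divides\<^bsub>Z_adj \<zeta>\<^esub> \<rho>"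
  shows "\<pi> \<sim>\<^bsub>Z_adj \<zeta>\<^esub> \<rho>"
proof -
  obtain c where c: "c \<in> carrier (Z_adj \<zeta>)" "\<rho> = \<pi> * c"
    using assms(3) by (auto simp: Z_adj_divides_iff)
  have "\<rho> divides\<^bsub>Z_adj \<zeta>\<^esub> (\<pi> * c)" by (auto simp: Z_adj_divides_iff c(2) intro!: bexI[of _ 1])
  hence "\<rho> divides\<^bsub>Z_adj \<zeta>\<^esub> \<pi> \<or> \<rho> divides\<^bsub>Z_adj \<zeta>\<^esub> c"
    using prime_elementsD(1)[OF assms(1)] c(1) prime_elementsD(5)[OF assms(2)] by blast
  moreover have False if div: "\<rho> divides\<^bsub>Z_adj \<zeta>\<^esub> c"
  proof -
    obtain d where d: "d \<in> carrier (Z_adj \<zeta>)" "c = \<rho> * d"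
      using div unfolding Z_adj_divides_iff by blast
    have "\<rho> * (\<pi> * d) = \<rho> * 1" using c(2) d(2) by (simp add: algebra_simps)
    hence "\<pi> * d = 1" using prime_elementsD(2)[OF assms(2)] by simp
    thus False using d(1) prime_element_not_divides_one[OF assms(1)]
      unfolding Z_adj_divides_iff by metis
  qed
  ultimately show ?thesis using assms(3) by (auto simp: associated_def)
qed

text \<open>Padding with exponent 0 only adds factors 1. It lets the index set grow from
  \<open>S\<close> to \<open>T\<close>, so that a further prime can be put into a
  decomposition.\<close>

lemma prime_decomposition_restrict:
  assumes "prime_decomposition \<zeta> P \<alpha> S e" "S \<subseteq> T" "T \<subseteq> P" "finite T"
  shows "prime_decomposition \<zeta> P \<alpha> T (\<lambda>\<pi>. if \<pi> \<in> S then e \<pi> else 0)"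
proof -
  have "(\<Prod>\<pi>\<in>S. \<pi> ^ e \<pi>) = (\<Prod>\<pi>\<in>T. \<pi> ^ (if \<pi> \<in> S then e \<pi> else 0))"
    using assms by (intro prod.mono_neutral_cong_left) auto
  thus ?thesis using assms by (auto simp: prime_decomposition_def)
qed

section \<open>Factorization into chosen representatives of the classes of associates\<close>

locale prime_representatives =
  fixes \<zeta> :: complex and P :: "complex set"
  assumes factorial: "factorial_domain (Z_adj \<zeta>)"
    and P_prime: "P \<subseteq> prime_elements \<zeta>"
    and P_rep: "\<And>\<pi>. \<pi> \<in> prime_elements \<zeta> \<Longrightarrow> \<exists>!\<psi>. \<psi> \<in> P \<and> \<psi> \<in> associates \<zeta> \<pi>"
begin

text \<open>A prime dividing a power of \<rho> divides \<rho>, hence is associated to \<rho>, and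
  each class has only one representative in \<open>P\<close>.\<close>

lemma divides_power_imp_eq:
  assumes "\<pi> \<in> P" "\<rho> \<in> P" "\<pi> divides\<^bsub>Z_adj \<zeta>\<^esub> \<rho> ^ n"
  shows "\<pi> = \<rho>"
proof -
  have pr: "\<pi> \<in> prime_elements \<zeta>" "\<rho> \<in> prime_elements \<zeta>" using assms P_prime by auto
  have "\<pi> divides\<^bsub>Z_adj \<zeta>\<^esub> \<rho>"
    using prime_element_divides_power[OF pr(1) _ assms(3)] prime_elementsD(1)[OF pr(2)] by blast
  hence "\<pi> \<in> associates \<zeta> \<rho>"
    using prime_elements_divides_imp_associated[OF pr] prime_elementsD(1)[OF pr(1)]
    by (simp add: associates_def)
  moreover have "\<rho> \<in> associates \<zeta> \<rho>"
    using prime_elementsD(1)[OF pr(2)]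
    by (auto simp: associates_def associated_def Z_adj_divides_iff intro!: bexI[of _ 1])
  ultimately show ?thesis using P_rep[OF pr(2)] assms(1,2) by blast
qed

text \<open>Splitting off the power of \<pi> gives \<open>\<alpha> = \<pi> ^ k * m\<close>, where
  \<pi> does not divide \<open>m\<close>: it would divide a unit or a power of another
  representative. The exponents are thereby described by divisibility alone, independently of the
  decomposition.\<close>

lemma prime_decomposition_power_divides_iff:
  assumes "prime_decomposition \<zeta> P \<alpha> S e" "\<pi> \<in> P"
  shows "\<pi> ^ n divides\<^bsub>Z_adj \<zeta>\<^esub> \<alpha> \<longleftrightarrow> n \<le> (if \<pi> \<in> S then e \<pi> else 0)"
proof -
  define k where "k = (if \<pi> \<in> S then e \<pi> else 0)"
  obtain \<epsilon> where fin: "finite S" and SP: "S \<subseteq> P" and \<epsilon>: "\<epsilon> \<in> Units (Z_adj \<zeta>)"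
    and \<alpha>: "\<alpha> = \<epsilon> * (\<Prod>\<pi>\<in>S. \<pi> ^ e \<pi>)"
    using assms(1) by (auto simp: prime_decomposition_def)
  define m where "m = \<epsilon> * (\<Prod>\<rho>\<in>S-{\<pi>}. \<rho> ^ e \<rho>)"
  have pr: "\<pi> \<in> prime_elements \<zeta>" using assms(2) P_prime by auto
  have SR: "\<rho> ^ l \<in> carrier (Z_adj \<zeta>)" if "\<rho> \<in> P" for \<rho> l
    using that P_prime prime_elementsD(1) by blast
  obtain \<epsilon>' where \<epsilon>': "\<epsilon>' \<in> carrier (Z_adj \<zeta>)" "\<epsilon> * \<epsilon>' = 1" and \<epsilon>R: "\<epsilon> \<in> carrier (Z_adj \<zeta>)"
    using \<epsilon> by (auto simp: Z_adj_Units_iff)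
  have prodR: "(\<Prod>\<rho>\<in>S-{\<pi>}. \<rho> ^ e \<rho>) \<in> carrier (Z_adj \<zeta>)" using SP SR by auto
  have mR: "m \<in> carrier (Z_adj \<zeta>)" unfolding m_def using \<epsilon>R prodR by auto
  have \<alpha>m: "\<alpha> = \<pi> ^ k * m"
    \<comment> \<open>If \<pi> is not in \<open>S\<close>, then \<open>k\<close> is 0 and removing
      \<pi> from \<open>S\<close> changes nothing.\<close>
    using prod.remove[OF fin, of \<pi> "\<lambda>\<pi>. \<pi> ^ e \<pi>"] by (cases "\<pi> \<in> S") (auto simp: \<alpha> m_def k_def)
  have ndvd: "\<not> \<pi> divides\<^bsub>Z_adj \<zeta>\<^esub> m"
  proof
    assume "\<pi> divides\<^bsub>Z_adj \<zeta>\<^esub> m"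
    moreover have "\<not> \<pi> divides\<^bsub>Z_adj \<zeta>\<^esub> \<epsilon>"
      using Z_adj_divides_multL[of \<zeta> \<pi> \<epsilon> \<epsilon>'] \<epsilon>' prime_element_not_divides_one[OF pr] by auto
    ultimately have "\<pi> divides\<^bsub>Z_adj \<zeta>\<^esub> (\<Prod>\<rho>\<in>S-{\<pi>}. \<rho> ^ e \<rho>)"
      using prime_elementsD(5)[OF pr \<epsilon>R prodR] by (auto simp: m_def)
    then obtain \<rho> where "\<rho> \<in> S - {\<pi>}" "\<pi> divides\<^bsub>Z_adj \<zeta>\<^esub> \<rho> ^ e \<rho>"
      using prime_element_divides_prod[OF pr, of "S - {\<pi>}" "\<lambda>\<rho>. \<rho> ^ e \<rho>"] SP SR by blast
    thus False using divides_power_imp_eq[OF assms(2)] SP by blast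
  qed
  have "\<pi> ^ n divides\<^bsub>Z_adj \<zeta>\<^esub> \<alpha> \<longleftrightarrow> n \<le> k"
  proof
    assume "n \<le> k"
    hence "\<alpha> = \<pi> ^ n * (\<pi> ^ (k - n) * m)" by (simp add: \<alpha>m flip: power_add mult.assoc)
    thus "\<pi> ^ n divides\<^bsub>Z_adj \<zeta>\<^esub> \<alpha>"
      using SR[OF assms(2)] mR unfolding Z_adj_divides_iff by blast
  next
    assume "\<pi> ^ n divides\<^bsub>Z_adj \<zeta>\<^esub> \<alpha>"
    then obtain c where c: "c \<in> carrier (Z_adj \<zeta>)" "\<pi> ^ k * m = \<pi> ^ n * c"
      by (auto simp: Z_adj_divides_iff \<alpha>m)
    show "n \<le> k"
    proof (rule ccontr)
      assume "\<not> n \<le> k"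
      then obtain d where d: "n = k + Suc d" by (metis add_Suc_right less_iff_Suc_add not_le)
      \<comment> \<open>Here \<open>n\<close> exceeds \<open>k\<close> by \<open>Suc d\<close>, so
        cancelling \<open>\<pi> ^ k\<close> leaves at least one factor \<pi> in
        \<open>m\<close>.\<close>
      have "\<pi> ^ k * m = \<pi> ^ k * (\<pi> * (\<pi> ^ d * c))"
        using c(2) by (simp add: d power_add mult.assoc)
      hence "m = \<pi> * (\<pi> ^ d * c)" using prime_elementsD(2)[OF pr] by simp
      thus False using ndvd c(1) SR[OF assms(2), of d] unfolding Z_adj_divides_iff by blast
    qed
  qed
  thus ?thesis by (simp add: k_def)
qed

lemma prime_decomposition_exponents_unique:
  assumes "prime_decomposition \<zeta> P \<alpha> S e" "prime_decomposition \<zeta> P \<alpha> T f" "\<pi> \<in> P"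
  shows "(if \<pi> \<in> S then e \<pi> else 0) = (if \<pi> \<in> T then f \<pi> else 0)"
  using prime_decomposition_power_divides_iff[OF assms(1,3)]
    prime_decomposition_power_divides_iff[OF assms(2,3)]
  by (intro order.antisym) blast+

text \<open>Shows that the definite description in \<open>sigma\<close> is well-defined. Two
  decompositions are compared over the union of their index sets, where their padded exponents
  agree.\<close>

lemma sigma_eq:
  assumes "prime_decomposition \<zeta> P \<alpha> S e"
  shows "sigma \<zeta> P \<alpha> = (\<Prod>\<pi>\<in>S. (\<pi> ^ (e \<pi> + 1) - 1) / (\<pi> - 1))"
  unfolding sigma_def
proof (rule the_equality)
  show "\<exists>S' e'. prime_decomposition \<zeta> P \<alpha> S' e' \<and> (\<Prod>\<pi>\<in>S. (\<pi> ^ (e \<pi> + 1) - 1) / (\<pi> - 1)) =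
    (\<Prod>\<pi>\<in>S'. (\<pi> ^ (e' \<pi> + 1) - 1) / (\<pi> - 1))"
    using assms by blast
next
  fix s assume "\<exists>S e. prime_decomposition \<zeta> P \<alpha> S e \<and> s = (\<Prod>\<pi>\<in>S. (\<pi> ^ (e \<pi> + 1) - 1) / (\<pi> - 1))"
  then obtain T f where T: "prime_decomposition \<zeta> P \<alpha> T f"
    and s: "s = (\<Prod>\<pi>\<in>T. (\<pi> ^ (f \<pi> + 1) - 1) / (\<pi> - 1))" by blast
  define g where "g = (\<lambda>\<pi>::complex. if \<pi> \<in> S then e \<pi> else 0)"
  define h where "h = (\<lambda>\<pi>::complex. if \<pi> \<in> T then f \<pi> else 0)"
  have fin: "finite S" "finite T" "S \<subseteq> P" "T \<subseteq> P"
    using assms T unfolding prime_decomposition_def by blast+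
  have ne1: "\<pi> - 1 \<noteq> 0" if "\<pi> \<in> P" for \<pi> using that P_prime prime_elementsD(4)[of \<pi> \<zeta>] by auto
  \<comment> \<open>A prime added with exponent 0 contributes
    \<open>(\<pi> - 1) / (\<pi> - 1)\<close>, which is 1 because \<pi> differs from 1.\<close>
  have "s = (\<Prod>\<pi>\<in>S \<union> T. (\<pi> ^ (h \<pi> + 1) - 1) / (\<pi> - 1))"
    unfolding s using fin ne1 by (intro prod.mono_neutral_cong_left) (auto simp: h_def)
  also have "\<dots> = (\<Prod>\<pi>\<in>S \<union> T. (\<pi> ^ (g \<pi> + 1) - 1) / (\<pi> - 1))"
  proof (rule prod.cong)
    fix \<pi> assume "\<pi> \<in> S \<union> T"
    hence "h \<pi> = g \<pi>"
      using prime_decomposition_exponents_unique[OF assms T, of \<pi>] fin unfolding g_def h_def by auto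
    thus "(\<pi> ^ (h \<pi> + 1) - 1) / (\<pi> - 1) = (\<pi> ^ (g \<pi> + 1) - 1) / (\<pi> - 1)" by simp
  qed simp
  also have "\<dots> = (\<Prod>\<pi>\<in>S. (\<pi> ^ (e \<pi> + 1) - 1) / (\<pi> - 1))"
    using fin ne1 by (intro prod.mono_neutral_cong_right) (auto simp: g_def)
  finally show "s = (\<Prod>\<pi>\<in>S. (\<pi> ^ (e \<pi> + 1) - 1) / (\<pi> - 1))" .
qed

text \<open>The prime \<pi> is a unit times its representative \<rho>. The unit goes into the
  leading unit; \<rho> is first inserted with exponent 0 if it is missing, and then its exponent is
  raised by one.\<close>

lemma prime_decomposition_prime_mult:
  assumes "prime_decomposition \<zeta> P \<alpha> S e" "\<pi> \<in> prime_elements \<zeta>"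
  shows "\<exists>T f. prime_decomposition \<zeta> P (\<pi> * \<alpha>) T f"
proof -
  interpret factorial_domain "Z_adj \<zeta>" by (rule factorial)
  obtain \<rho> where \<rho>: "\<rho> \<in> P" "\<rho> \<in> associates \<zeta> \<pi>" using P_rep[OF assms(2)] by blast
  hence "\<pi> \<sim>\<^bsub>Z_adj \<zeta>\<^esub> \<rho>" "\<rho> \<in> carrier (Z_adj \<zeta>)" by (auto simp: associates_def associated_def)
  then obtain u where u: "u \<in> Units (Z_adj \<zeta>)" "\<pi> = u * \<rho>"
    using ring_associated_iff[OF prime_elementsD(1)[OF assms(2)]] by auto
  define T where "T = insert \<rho> S"
  define e' where "e' = (\<lambda>\<pi>. if \<pi> \<in> S then e \<pi> else 0)"
  have "prime_decomposition \<zeta> P \<alpha> T e'" unfolding T_def e'_def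
    using assms(1) \<rho>(1) prime_decomposition_restrict[OF assms(1), of "insert \<rho> S"]
    by (auto simp: prime_decomposition_def)
  then obtain \<epsilon> where T: "finite T" "T \<subseteq> P" "\<epsilon> \<in> Units (Z_adj \<zeta>)" "\<alpha> = \<epsilon> * (\<Prod>\<pi>\<in>T. \<pi> ^ e' \<pi>)"
    by (auto simp: prime_decomposition_def)
  have "\<rho> \<in> T" by (simp add: T_def)
  have "(\<Prod>\<pi>\<in>T - {\<rho>}. \<pi> ^ (e'(\<rho> := Suc (e' \<rho>))) \<pi>) = (\<Prod>\<pi>\<in>T - {\<rho>}. \<pi> ^ e' \<pi>)"
    by (rule prod.cong) auto
  hence "(\<Prod>\<pi>\<in>T. \<pi> ^ (e'(\<rho> := Suc (e' \<rho>))) \<pi>) = \<rho> * (\<Prod>\<pi>\<in>T. \<pi> ^ e' \<pi>)"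
    using prod.remove[OF T(1) \<open>\<rho> \<in> T\<close>, of "\<lambda>\<pi>. \<pi> ^ (e'(\<rho> := Suc (e' \<rho>))) \<pi>"]
      prod.remove[OF T(1) \<open>\<rho> \<in> T\<close>, of "\<lambda>\<pi>. \<pi> ^ e' \<pi>"]
    by simp
  hence "\<pi> * \<alpha> = (u * \<epsilon>) * (\<Prod>\<pi>\<in>T. \<pi> ^ (e'(\<rho> := Suc (e' \<rho>))) \<pi>)"
    by (simp add: u(2) T(4))
  hence "prime_decomposition \<zeta> P (\<pi> * \<alpha>) T (e'(\<rho> := Suc (e' \<rho>)))"
    unfolding prime_decomposition_def using T Z_adj_Units_mult[OF u(1) T(3)] by blast
  thus ?thesis by blast
qed

text \<open>A factorial domain gives a list of irreducible factors in its multiplicative monoid.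
  These are prime, so they can be absorbed one at a time by induction over the list.\<close>

lemma prime_decomposition_exists:
  assumes "\<alpha> \<in> carrier (Z_adj \<zeta>)" "\<alpha> \<noteq> 0"
  shows "\<exists>S e. prime_decomposition \<zeta> P \<alpha> S e"
proof -
  interpret factorial_domain "Z_adj \<zeta>" by (rule factorial)
  \<comment> \<open>Units decompose over the empty index set; they are treated apart from the
    factorization of non-units and also start the induction.\<close>
  have unit: "\<exists>S e. prime_decomposition \<zeta> P u S e" if "u \<in> Units (Z_adj \<zeta>)" for u
    using that by (intro exI[of _ "{}"]) (auto simp: prime_decomposition_def)
  show ?thesis
  proof (cases "\<alpha> \<in> Units (Z_adj \<zeta>)")
    case False
    then obtain fs where fs: "set fs \<subseteq> carrier (mult_of (Z_adj \<zeta>))" "factors (mult_of (Z_adj \<zeta>)) fs \<alpha>"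
      using factors_exist[of \<alpha>] assms by auto
    have "set fs \<subseteq> prime_elements \<zeta>"
    proof
      fix x assume x: "x \<in> set fs"
      hence "irreducible (mult_of (Z_adj \<zeta>)) x" using fs(2) by (auto simp: factors_def)
      hence "Divisibility.prime (mult_of (Z_adj \<zeta>)) x" using x fs(1) irreducible_prime by auto
      thus "x \<in> prime_elements \<zeta>"
        using x fs(1) ring_primeI'[of x] by (auto simp: prime_elements_def)
    qed
    hence "\<exists>S e. prime_decomposition \<zeta> P (foldr (*) fs 1) S e"
    proof (induction fs)
      case Nil
      thus ?case using unit[of 1] by (auto simp: Z_adj_Units_iff)
    next
      case (Cons x fs)
      thus ?case using prime_decomposition_prime_mult by fastforce
    qed
    thus ?thesis using fs(2) by (simp add: factors_def)
  qed (rule unit)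
qed

text \<open>By the power criterion with \<open>n = 1\<close>, the members of \<open>P\<close>
  dividing \<alpha> are those with positive exponent; dropping the others removes only factors 1.
  This index set fits the sets of prime divisors in the theorem.\<close>

lemma prime_decomposition_divisors:
  assumes "\<alpha> \<in> carrier (Z_adj \<zeta>)" "\<alpha> \<noteq> 0"
  obtains e where "prime_decomposition \<zeta> P \<alpha> {\<pi> \<in> P. \<pi> divides\<^bsub>Z_adj \<zeta>\<^esub> \<alpha>} e"
proof -
  obtain S e where dec: "prime_decomposition \<zeta> P \<alpha> S e"
    using prime_decomposition_exists[OF assms] by blast
  have div: "{\<pi> \<in> P. \<pi> divides\<^bsub>Z_adj \<zeta>\<^esub> \<alpha>} = {\<pi> \<in> S. 1 \<le> e \<pi>}"
    using prime_decomposition_power_divides_iff[OF dec, where n = 1] dec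
    by (auto simp: prime_decomposition_def split: if_splits)
  have "(\<Prod>\<pi>\<in>S. \<pi> ^ e \<pi>) = (\<Prod>\<pi>\<in>{\<pi> \<in> S. 1 \<le> e \<pi>}. \<pi> ^ e \<pi>)"
    using dec
    by (intro prod.mono_neutral_cong_right) (auto simp: prime_decomposition_def not_less_eq_eq)
  hence "prime_decomposition \<zeta> P \<alpha> {\<pi> \<in> S. 1 \<le> e \<pi>} e"
    using dec by (auto simp: prime_decomposition_def)
  thus ?thesis using that by (simp add: div)
qed

end

section \<open>Embeddings and the norm modulo \<open>1 - \<zeta>\<close>\<close>

lemma embeddingsD:
  assumes "\<phi> \<in> embeddings \<zeta>"
  shows "\<phi> 1 = 1"
    and "\<And>x y. x \<in> carrier (Q_adj \<zeta>) \<Longrightarrow> y \<in> carrier (Q_adj \<zeta>) \<Longrightarrow> \<phi> (x + y) = \<phi> x + \<phi> y"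
    and "\<And>x y. x \<in> carrier (Q_adj \<zeta>) \<Longrightarrow> y \<in> carrier (Q_adj \<zeta>) \<Longrightarrow> \<phi> (x * y) = \<phi> x * \<phi> y"
    and "\<And>x. x \<notin> carrier (Q_adj \<zeta>) \<Longrightarrow> \<phi> x = undefined"
  using assms by (auto simp: embeddings_def ring_hom_def extensional_def)

lemma embedding_uminus:
  assumes "\<phi> \<in> embeddings \<zeta>" "x \<in> carrier (Q_adj \<zeta>)"
  shows "\<phi> (- x) = - \<phi> x"
proof -
  have "0 \<in> carrier (Q_adj \<zeta>)" using Z_adj_subset_Q_adj by auto
  hence "\<phi> 0 = 0" using embeddingsD(2)[OF assms(1), of 0 0] by simp
  moreover have "\<phi> (x + - x) = \<phi> x + \<phi> (- x)"
    using embeddingsD(2)[OF assms(1)] assms(2) Q_adj_uminus by blast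
  ultimately show ?thesis by (simp add: add_eq_0_iff)
qed

lemma embedding_inverse:
  assumes "\<phi> \<in> embeddings \<zeta>" "x \<in> carrier (Q_adj \<zeta>)" "x \<noteq> 0"
  shows "\<phi> x * \<phi> (inverse x) = 1"
  using embeddingsD(3)[OF assms(1,2) Q_adj_inverse[OF assms(2,3)]] embeddingsD(1)[OF assms(1)]
    assms(3) by simp

lemma embedding_power:
  assumes "\<phi> \<in> embeddings \<zeta>" "x \<in> carrier (Z_adj \<zeta>)"
  shows "\<phi> (x ^ n) = \<phi> x ^ n"
proof (induction n)
  case (Suc n)
  have "x \<in> carrier (Q_adj \<zeta>)" "x ^ n \<in> carrier (Q_adj \<zeta>)"
    using assms(2) Z_adj_subset_Q_adj by (auto dest!: subsetD)
  thus ?case using Suc embeddingsD(3)[OF assms(1)] by simp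
qed (use embeddingsD(1)[OF assms(1)] in simp)

text \<open>Agreement at \<zeta> spreads through the field operations, for inverses by their
  uniqueness. Outside the field both maps are \<open>undefined\<close> by extensionality.\<close>

lemma embedding_eqI:
  assumes "\<phi> \<in> embeddings \<zeta>" "\<phi>' \<in> embeddings \<zeta>" "\<phi> \<zeta> = \<phi>' \<zeta>"
  shows "\<phi> = \<phi>'"
proof
  fix x
  show "\<phi> x = \<phi>' x"
  proof (cases "x \<in> carrier (Q_adj \<zeta>)")
    case True
    thus ?thesis
    proof (induction rule: Q_adj_induct)
      case (inverse x)
      thus ?case using embedding_inverse[OF assms(1) inverse(1,2)]
          embedding_inverse[OF assms(2) inverse(1,2)] by (metis inverse_unique)
    qed (use assms embeddingsD[OF assms(1)] embeddingsD[OF assms(2)]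
        embedding_uminus[OF assms(1)] embedding_uminus[OF assms(2)] in auto)
  qed (use embeddingsD(4) assms(1,2) in metis)
qed

text \<open>The identity has to be restricted to be extensional. It guarantees a factor of the norm
  that comes from the element itself.\<close>

lemma identity_embedding: "restrict id (carrier (Q_adj \<zeta>)) \<in> embeddings \<zeta>"
proof -
  have "1 \<in> carrier (Q_adj \<zeta>)" using Z_adj_subset_Q_adj by auto
  thus ?thesis
    using generate_field.eng_add[of _ complex_ring "{\<zeta>}"]
      generate_field.eng_mult[of _ complex_ring "{\<zeta>}"]
    by (auto simp: embeddings_def ring_hom_def Q_adj_def)
qed

lemma field_norm_mult:
  assumes "x \<in> carrier (Z_adj \<zeta>)" "y \<in> carrier (Z_adj \<zeta>)"
  shows "field_norm \<zeta> (x * y) = field_norm \<zeta> x * field_norm \<zeta> y"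
  unfolding field_norm_def prod.distrib[symmetric]
  using assms Z_adj_subset_Q_adj by (intro prod.cong refl embeddingsD(3)) auto

text \<open>The first \<open>n\<close> powers of \<zeta> are distinct roots of
  \<open>z ^ n = 1\<close>, and there are only \<open>n\<close> such roots.\<close>

lemma primitive_root_of_unity_powers:
  assumes "primitive_root_of_unity n \<zeta>" "n > 0" "z ^ n = 1"
  shows "\<exists>k<n. z = \<zeta> ^ k"
proof -
  have z1: "\<zeta> ^ n = 1" and min: "\<And>k. 0 < k \<Longrightarrow> k < n \<Longrightarrow> \<zeta> ^ k \<noteq> 1"
    using assms(1) by (auto simp: primitive_root_of_unity_def)
  have "\<zeta> \<noteq> 0" using z1 assms(2) by (metis power_0_left zero_neq_one not_gr_zero)
  have "inj_on (\<lambda>k. \<zeta> ^ k) {..<n}"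
  proof (rule linorder_inj_onI)
    fix i j assume "i < j" "i \<in> {..<n}" "j \<in> {..<n}"
    hence "\<zeta> ^ j = \<zeta> ^ i * \<zeta> ^ (j - i)" "\<zeta> ^ (j - i) \<noteq> 1"
      using min[of "j - i"] by (auto simp flip: power_add)
    thus "\<zeta> ^ i \<noteq> \<zeta> ^ j" using \<open>\<zeta> \<noteq> 0\<close> by auto
  qed auto
  hence "card ((\<lambda>k. \<zeta> ^ k) ` {..<n}) = n" by (simp add: card_image)
  moreover have "(\<lambda>k. \<zeta> ^ k) ` {..<n} \<subseteq> {z. z ^ n = 1}"
    using z1 by (auto simp flip: power_mult) (metis mult.commute power_mult power_one)
  ultimately have "(\<lambda>k. \<zeta> ^ k) ` {..<n} = {z. z ^ n = 1}"
    using assms(2) card_roots_unity_eq[of n] finite_roots_unity[of n]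
    by (intro card_subset_eq) auto
  thus ?thesis using assms(3) by blast
qed

section \<open>Arithmetic modulo the prime \<open>1 - \<zeta>\<close>\<close>

locale cyclotomic =
  fixes p :: nat and \<zeta> :: complex
  assumes prime_p: "Factorial_Ring.prime p"
    and root: "primitive_root_of_unity p \<zeta>"
    and one_minus_prime: "1 - \<zeta> \<in> prime_elements \<zeta>"
begin

lemma root_power: "\<zeta> ^ p = 1"
  using root by (simp add: primitive_root_of_unity_def)

lemma root_neq_one: "\<zeta> \<noteq> 1"
  using root prime_gt_1_nat[OF prime_p] by (auto simp: primitive_root_of_unity_def)

text \<open>Since the powers of \<zeta> sum to 0, \<open>p\<close> is the sum of the terms
  \<open>1 - \<zeta> ^ i\<close>, all divisible by \<open>1 - \<zeta>\<close>. Conversely, if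
  \<open>p\<close> did not divide \<open>n\<close>, Bezout would write 1 as a combination of
  \<open>p\<close> and \<open>n\<close>, and the prime \<open>1 - \<zeta>\<close> would divide
  1.\<close>

lemma one_minus_divides_of_int_iff: "(1 - \<zeta>) divides\<^bsub>Z_adj \<zeta>\<^esub> of_int n \<longleftrightarrow> int p dvd n"
proof
  have p: "(1 - \<zeta>) divides\<^bsub>Z_adj \<zeta>\<^esub> of_nat p"
  proof -
    have "(\<Sum>i<p. \<zeta> ^ i) = 0"
      using root_power root_neq_one one_diff_power_eq[of \<zeta> p] by simp
    moreover have "(1 - \<zeta>) divides\<^bsub>Z_adj \<zeta>\<^esub> (\<Sum>i<p. 1 ^ i - \<zeta> ^ i)"
      by (intro Z_adj_divides_sum Z_adj_divides_power_cong)
        (auto simp: Z_adj_divides_iff intro!: bexI[of _ 1])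
    ultimately show ?thesis by (simp add: sum_subtractf)
  qed
  {
    assume "int p dvd n"
    then obtain q where "n = int p * q" by auto
    thus "(1 - \<zeta>) divides\<^bsub>Z_adj \<zeta>\<^esub> of_int n" using Z_adj_divides_multL[OF p, of "of_int q"] by simp
  }
  assume n: "(1 - \<zeta>) divides\<^bsub>Z_adj \<zeta>\<^esub> of_int n"
  show "int p dvd n"
  proof (rule ccontr)
    assume "\<not> int p dvd n"
    hence "coprime (int p) n" using prime_p by (simp add: prime_imp_coprime)
    then obtain u v where "u * int p + v * n = 1" using bezout_int[of "int p" n]
      by (auto simp: coprime_iff_gcd_eq_1)
    hence "of_int (int p * u + n * v) = (1 :: complex)" by (simp add: algebra_simps)
    moreover have "(1 - \<zeta>) divides\<^bsub>Z_adj \<zeta>\<^esub> of_int (int p * u + n * v)"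
      using p n by (auto intro!: Z_adj_divides_add Z_adj_divides_multL)
    ultimately show False using prime_element_not_divides_one[OF one_minus_prime] by simp
  qed
qed

lemma one_minus_divides_of_nat_iff: "(1 - \<zeta>) divides\<^bsub>Z_adj \<zeta>\<^esub> of_nat n \<longleftrightarrow> p dvd n"
  using one_minus_divides_of_int_iff[of "int n"] by simp

text \<open>Modulo \<open>1 - \<zeta>\<close> the generator \<zeta> is 1, so every element built
  from it is congruent to an integer, which is then reduced modulo \<open>p\<close>.\<close>

lemma residue_exists:
  assumes "x \<in> carrier (Z_adj \<zeta>)"
  shows "\<exists>j<p. (1 - \<zeta>) divides\<^bsub>Z_adj \<zeta>\<^esub> (x - of_nat j)"
proof -
  have "\<exists>n. (1 - \<zeta>) divides\<^bsub>Z_adj \<zeta>\<^esub> (x - of_int n)"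
    using assms
  proof (induction rule: Z_adj_induct)
    case one
    show ?case by (rule exI[of _ 1]) (simp add: Z_adj_divides_zero)
  next
    case gen
    show ?case by (rule exI[of _ 1]) (auto simp: Z_adj_divides_iff intro!: bexI[of _ "- 1"])
  next
    case (uminus x)
    then obtain n where "(1 - \<zeta>) divides\<^bsub>Z_adj \<zeta>\<^esub> (x - of_int n)" by blast
    from Z_adj_divides_uminus[OF this] show ?case by (intro exI[of _ "- n"]) (simp add: add.commute)
  next
    case (add x y)
    then obtain m n where "(1 - \<zeta>) divides\<^bsub>Z_adj \<zeta>\<^esub> (x - of_int m)"
      "(1 - \<zeta>) divides\<^bsub>Z_adj \<zeta>\<^esub> (y - of_int n)" by blast
    from Z_adj_divides_add[OF this] show ?case
      by (intro exI[of _ "m + n"]) (simp add: algebra_simps)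
  next
    case (mult x y)
    then obtain m n where "(1 - \<zeta>) divides\<^bsub>Z_adj \<zeta>\<^esub> (x - of_int m)"
      "(1 - \<zeta>) divides\<^bsub>Z_adj \<zeta>\<^esub> (y - of_int n)" by blast
    from Z_adj_divides_mult_cong[OF this mult(2)] show ?case
      by (intro exI[of _ "m * n"]) simp
  qed
  then obtain n where n: "(1 - \<zeta>) divides\<^bsub>Z_adj \<zeta>\<^esub> (x - of_int n)" by blast
  have p0: "p > 0" using prime_gt_0_nat[OF prime_p] .
  have "(1 - \<zeta>) divides\<^bsub>Z_adj \<zeta>\<^esub> of_int (n - n mod int p)"
    by (subst one_minus_divides_of_int_iff) simp
  from Z_adj_divides_add[OF n this]
  have "(1 - \<zeta>) divides\<^bsub>Z_adj \<zeta>\<^esub> (x - of_int (int (nat (n mod int p))))"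
    using p0 by simp
  thus ?thesis using p0 by (intro exI[of _ "nat (n mod int p)"]) (auto simp: nat_less_iff)
qed

lemma embedding_root:
  assumes "\<phi> \<in> embeddings \<zeta>"
  shows "\<exists>k. \<phi> \<zeta> = \<zeta> ^ k"
proof -
  have "\<phi> \<zeta> ^ p = 1"
    using embedding_power[OF assms Z_adj_gen, of p] embeddingsD(1)[OF assms] by (simp add: root_power)
  thus ?thesis using primitive_root_of_unity_powers[OF root] prime_gt_0_nat[OF prime_p] by blast
qed

text \<open>An embedding is determined by the image of \<zeta>, a \<open>p\<close>-th root of unity.
  Finiteness is what allows single factors to be split off the norm, as a product over an infinite
  set is 1 by convention.\<close>

lemma finite_embeddings: "finite (embeddings \<zeta>)"
proof (rule inj_on_finite)
  show "inj_on (\<lambda>\<phi>. \<phi> \<zeta>) (embeddings \<zeta>)"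
    by (intro inj_onI) (rule embedding_eqI)
  show "(\<lambda>\<phi>. \<phi> \<zeta>) ` embeddings \<zeta> \<subseteq> {z. z ^ p = 1}"
    using embedding_root root_power by (auto simp flip: power_mult)
      (metis mult.commute power_mult power_one)
  show "finite {z::complex. z ^ p = 1}"
    using prime_gt_0_nat[OF prime_p] by (intro finite_roots_unity) simp
qed

text \<open>Both \<zeta> and its image, a power of \<zeta>, are congruent to 1; the congruence is
  inherited by negatives, sums and products.\<close>

lemma embedding_cong:
  assumes "\<phi> \<in> embeddings \<zeta>" "x \<in> carrier (Z_adj \<zeta>)"
  shows "\<phi> x \<in> carrier (Z_adj \<zeta>)" "(1 - \<zeta>) divides\<^bsub>Z_adj \<zeta>\<^esub> (\<phi> x - x)"
proof -
  have Q: "y \<in> carrier (Q_adj \<zeta>)" if "y \<in> carrier (Z_adj \<zeta>)" for y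
    using that Z_adj_subset_Q_adj by auto
  have "\<phi> x \<in> carrier (Z_adj \<zeta>) \<and> (1 - \<zeta>) divides\<^bsub>Z_adj \<zeta>\<^esub> (\<phi> x - x)"
    using assms(2)
  proof (induction rule: Z_adj_induct)
    case one
    show ?case using embeddingsD(1)[OF assms(1)] by (auto intro: Z_adj_divides_zero)
  next
    case gen
    obtain k where k: "\<phi> \<zeta> = \<zeta> ^ k" using embedding_root[OF assms(1)] by blast
    have d: "(1 - \<zeta>) divides\<^bsub>Z_adj \<zeta>\<^esub> (\<zeta> - 1)"
      by (auto simp: Z_adj_divides_iff intro!: bexI[of _ "- 1"])
    have "(1 - \<zeta>) divides\<^bsub>Z_adj \<zeta>\<^esub> (\<zeta> ^ k - 1 ^ k - (\<zeta> - 1))"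
      by (intro Z_adj_divides_diff Z_adj_divides_power_cong d) auto
    thus ?case by (auto simp: k)
  next
    case (uminus x)
    thus ?case using embedding_uminus[OF assms(1) Q[OF uminus(1)]]
        Z_adj_divides_uminus[of \<zeta> "1 - \<zeta>" "\<phi> x - x"] by auto
  next
    case (add x y)
    thus ?case using embeddingsD(2)[OF assms(1) Q[OF add(1)] Q[OF add(2)]]
        Z_adj_divides_add[of \<zeta> "1 - \<zeta>" "\<phi> x - x" "\<phi> y - y"] by (auto simp: algebra_simps)
  next
    case (mult x y)
    thus ?case using embeddingsD(3)[OF assms(1) Q[OF mult(1)] Q[OF mult(2)]]
      by (auto intro!: Z_adj_divides_mult_cong)
  qed
  thus "\<phi> x \<in> carrier (Z_adj \<zeta>)" "(1 - \<zeta>) divides\<^bsub>Z_adj \<zeta>\<^esub> (\<phi> x - x)" by auto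
qed

lemma field_norm_closed: "x \<in> carrier (Z_adj \<zeta>) \<Longrightarrow> field_norm \<zeta> x \<in> carrier (Z_adj \<zeta>)"
  unfolding field_norm_def using embedding_cong(1) by auto

text \<open>Every conjugate of \<open>x\<close> is congruent to \<open>x\<close>. If the norm is
  divisible, primality singles out a divisible conjugate; conversely the identity embedding supplies
  a divisible factor.\<close>

lemma one_minus_divides_field_norm_iff:
  assumes "x \<in> carrier (Z_adj \<zeta>)"
  shows "(1 - \<zeta>) divides\<^bsub>Z_adj \<zeta>\<^esub> field_norm \<zeta> x \<longleftrightarrow> (1 - \<zeta>) divides\<^bsub>Z_adj \<zeta>\<^esub> x"
proof
  assume "(1 - \<zeta>) divides\<^bsub>Z_adj \<zeta>\<^esub> field_norm \<zeta> x"
  then obtain \<phi> where "\<phi> \<in> embeddings \<zeta>" "(1 - \<zeta>) divides\<^bsub>Z_adj \<zeta>\<^esub> \<phi> x"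
    unfolding field_norm_def
    using prime_element_divides_prod[OF one_minus_prime] embedding_cong(1) assms by metis
  thus "(1 - \<zeta>) divides\<^bsub>Z_adj \<zeta>\<^esub> x"
    using Z_adj_divides_cong[OF embedding_cong(2)] assms by blast
next
  define \<iota> where "\<iota> = restrict id (carrier (Q_adj \<zeta>))"
  have \<iota>: "\<iota> \<in> embeddings \<zeta>" unfolding \<iota>_def by (rule identity_embedding)
  assume "(1 - \<zeta>) divides\<^bsub>Z_adj \<zeta>\<^esub> x"
  hence "(1 - \<zeta>) divides\<^bsub>Z_adj \<zeta>\<^esub> \<iota> x"
    using Z_adj_divides_cong[OF embedding_cong(2)[OF \<iota> assms]] by blast
  thus "(1 - \<zeta>) divides\<^bsub>Z_adj \<zeta>\<^esub> field_norm \<zeta> x"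
    unfolding field_norm_def prod.remove[OF finite_embeddings \<iota>]
    using assms embedding_cong(1) by (intro Z_adj_divides_multL) auto
qed

lemma field_norm_one_minus_nonzero: "field_norm \<zeta> (1 - \<zeta>) \<noteq> 0"
proof
  assume "field_norm \<zeta> (1 - \<zeta>) = 0"
  then obtain \<phi> where \<phi>: "\<phi> \<in> embeddings \<zeta>" "\<phi> (1 - \<zeta>) = 0"
    by (auto simp: field_norm_def finite_embeddings)
  moreover have "1 - \<zeta> \<in> carrier (Q_adj \<zeta>)"
    using Z_adj_subset_Q_adj Z_adj_diff[OF Z_adj_one Z_adj_gen] by blast
  ultimately show False using embedding_inverse[OF \<phi>(1), of "1 - \<zeta>"] root_neq_one by auto
qed

text \<open>A second factor \<open>1 - \<zeta>\<close> of \<sigma> would survive after cancelling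
  one norm of \<open>1 - \<zeta>\<close>, so it would divide the norm of \<alpha> and hence
  \<alpha>.\<close>

lemma one_minus_exactly_divides:
  assumes "\<sigma> \<in> carrier (Z_adj \<zeta>)" "\<alpha> \<in> carrier (Z_adj \<zeta>)"
    and "field_norm \<zeta> \<sigma> = field_norm \<zeta> (1 - \<zeta>) * field_norm \<zeta> \<alpha>"
    and "\<not> (1 - \<zeta>) divides\<^bsub>Z_adj \<zeta>\<^esub> \<alpha>"
  shows "(1 - \<zeta>) divides\<^bsub>Z_adj \<zeta>\<^esub> \<sigma>" "\<not> ((1 - \<zeta>) * (1 - \<zeta>)) divides\<^bsub>Z_adj \<zeta>\<^esub> \<sigma>"
proof -
  have R: "1 - \<zeta> \<in> carrier (Z_adj \<zeta>)" by auto
  have div_norm: "(1 - \<zeta>) divides\<^bsub>Z_adj \<zeta>\<^esub> field_norm \<zeta> (1 - \<zeta>)"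
    by (subst one_minus_divides_field_norm_iff[OF R]) (auto simp: Z_adj_divides_iff intro!: bexI[of _ 1])
  have "(1 - \<zeta>) divides\<^bsub>Z_adj \<zeta>\<^esub> field_norm \<zeta> \<sigma>"
    unfolding assms(3) by (intro Z_adj_divides_multL div_norm field_norm_closed assms(2))
  thus "(1 - \<zeta>) divides\<^bsub>Z_adj \<zeta>\<^esub> \<sigma>" using one_minus_divides_field_norm_iff[OF assms(1)] by simp
  show "\<not> ((1 - \<zeta>) * (1 - \<zeta>)) divides\<^bsub>Z_adj \<zeta>\<^esub> \<sigma>"
  proof
    assume "((1 - \<zeta>) * (1 - \<zeta>)) divides\<^bsub>Z_adj \<zeta>\<^esub> \<sigma>"
    then obtain y where y: "y \<in> carrier (Z_adj \<zeta>)" "\<sigma> = (1 - \<zeta>) * ((1 - \<zeta>) * y)"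
      unfolding Z_adj_divides_iff mult.assoc by blast
    have "field_norm \<zeta> \<sigma> = field_norm \<zeta> (1 - \<zeta>) * (field_norm \<zeta> (1 - \<zeta>) * field_norm \<zeta> y)"
      by (simp only: y(2) field_norm_mult[OF R Z_adj_mult[OF R y(1)]] field_norm_mult[OF R y(1)])
    hence "field_norm \<zeta> \<alpha> = field_norm \<zeta> (1 - \<zeta>) * field_norm \<zeta> y"
      using assms(3) field_norm_one_minus_nonzero by simp
    hence "(1 - \<zeta>) divides\<^bsub>Z_adj \<zeta>\<^esub> field_norm \<zeta> \<alpha>"
      using Z_adj_divides_multL[OF div_norm field_norm_closed[OF y(1)]] by simp
    thus False using one_minus_divides_field_norm_iff[OF assms(2)] assms(4) by simp
  qed
qed

lemma one_minus_divides_geometric_sum_iff: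
  assumes "x \<in> carrier (Z_adj \<zeta>)" "(1 - \<zeta>) divides\<^bsub>Z_adj \<zeta>\<^esub> (x - of_nat j)"
  shows "(1 - \<zeta>) divides\<^bsub>Z_adj \<zeta>\<^esub> (\<Sum>i<n. x ^ i) \<longleftrightarrow> p dvd (\<Sum>i<n. j ^ i)"
proof -
  have "(1 - \<zeta>) divides\<^bsub>Z_adj \<zeta>\<^esub> (\<Sum>i<n. x ^ i - of_nat j ^ i)"
    using assms by (intro Z_adj_divides_sum Z_adj_divides_power_cong) auto
  hence "(1 - \<zeta>) divides\<^bsub>Z_adj \<zeta>\<^esub> ((\<Sum>i<n. x ^ i) - of_nat (\<Sum>i<n. j ^ i))"
    by (simp add: sum_subtractf)
  from Z_adj_divides_cong[OF this] show ?thesis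
    by (simp only: one_minus_divides_of_nat_iff)
qed

end

text \<open>Multiplying the sum by \<open>j - 1\<close>, which is prime to \<open>p\<close> because
  it lies strictly between 0 and \<open>p\<close>, gives \<open>j ^ n - 1\<close>. For
  \<open>j = 1\<close> this factor vanishes, hence the separate case in the theorem.\<close>

lemma prime_dvd_geometric_sum_iff:
  fixes p j n :: nat
  assumes "Factorial_Ring.prime p" "1 < j" "j < p"
  shows "p dvd (\<Sum>i<n. j ^ i) \<longleftrightarrow> ord p j dvd n"
proof -
  have "int j ^ n - 1 = (int j - 1) * (\<Sum>i<n. int j ^ i)" by (rule power_diff_1_eq)
  moreover have "\<not> int p dvd int j - 1" using assms zdvd_not_zless[of "int j - 1" "int p"] by auto
  ultimately have "int p dvd int j ^ n - 1 \<longleftrightarrow> int p dvd (\<Sum>i<n. int j ^ i)"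
    using assms(1) by (simp add: prime_dvd_mult_iff)
  also have "\<dots> \<longleftrightarrow> p dvd (\<Sum>i<n. j ^ i)" by (simp flip: of_nat_power of_nat_sum)
  also have "int p dvd int j ^ n - 1 \<longleftrightarrow> [j ^ n = 1] (mod p)"
    by (metis cong_iff_dvd_diff cong_int_iff of_nat_1 of_nat_power)
  finally show ?thesis by (simp only: ord_divides)
qed

text \<open>The number \<open>e + 1\<close> counts the terms of
  \<open>1 + \<psi> + ... + \<psi> ^ e\<close>, which is where the residue -1 in the theorem comes
  from.\<close>

lemma cong_minus_one_iff: "[int e = -1] (mod int t) \<longleftrightarrow> t dvd e + 1"
proof -
  have "int e - (- 1) = int (e + 1)" by simp
  thus ?thesis by (simp only: cong_iff_dvd_diff of_nat_dvd_iff)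
qed

section \<open>Prime factorization of an odd norm-perfect integer\<close>

theorem mainTheorem15:
  fixes p :: nat and \<zeta> \<alpha> :: complex and P :: "complex set"
  assumes "Factorial_Ring.prime p" and "odd p"
    and "primitive_root_of_unity p \<zeta>"
    and "factorial_domain (Z_adj \<zeta>)"
    and "positive_primes p \<zeta> P"
    and "1 - \<zeta> \<in> P"
    and "\<alpha> \<in> carrier (Z_adj \<zeta>)"
    and "odd_element \<zeta> \<alpha>"
    and "norm_perfect \<zeta> P \<alpha>"
  defines "Pj \<equiv> prime_divisors_mod \<zeta> P \<alpha>"
  shows "\<exists>\<epsilon> \<psi>\<^sub>0 k e.
    \<epsilon> \<in> Units (Z_adj \<zeta>) \<and>
    \<psi>\<^sub>0 \<in> (\<Union>j\<in>{1..p-1}. Pj j) \<and>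
    (\<forall>j\<in>{1..p-1}. finite (Pj j) \<and> (\<forall>\<psi>\<in>Pj j. odd_element \<zeta> \<psi>)) \<and>
    \<alpha> = \<epsilon> * \<psi>\<^sub>0 ^ k * (\<Prod>j=1..p-1. \<Prod>\<psi>\<in>Pj j - {\<psi>\<^sub>0}. \<psi> ^ e \<psi>) \<and>
    (\<forall>j\<in>{1..p-1}. j \<noteq> 1 \<longrightarrow>
       (\<forall>\<psi>\<in>Pj j - {\<psi>\<^sub>0}. \<not> [int (e \<psi>) = -1] (mod int (ord p j)))) \<and>
    (\<forall>\<psi>\<in>Pj 1 - {\<psi>\<^sub>0}. \<not> [int (e \<psi>) = -1] (mod int p)) \<and>
    (\<forall>j\<in>{1..p-1}. j \<noteq> 1 \<longrightarrow> \<psi>\<^sub>0 \<in> Pj j \<longrightarrow> [int k = -1] (mod int (ord p j))) \<and>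
    (\<psi>\<^sub>0 \<in> Pj 1 \<longrightarrow> [int k = -1] (mod int p))"
proof -
  interpret prime_representatives \<zeta> P
    using assms(4,5) by (intro prime_representatives.intro) (simp_all add: positive_primes_def)
  interpret cyclotomic p \<zeta>
    \<comment> \<open>Primality of \<open>1 - \<zeta>\<close> comes from its membership in
      \<open>P\<close>.\<close>
    using assms(1,3,6) P_prime by unfold_locales auto
  define S where "S = {\<pi> \<in> P. \<pi> divides\<^bsub>Z_adj \<zeta>\<^esub> \<alpha>}"
  have \<alpha>_odd: "\<not> (1 - \<zeta>) divides\<^bsub>Z_adj \<zeta>\<^esub> \<alpha>" using assms(8) by (simp add: odd_element_def)
  have "\<alpha> \<noteq> 0" using \<alpha>_odd Z_adj_divides_zero by metis
  then obtain e where dec: "prime_decomposition \<zeta> P \<alpha> S e"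
    using prime_decomposition_divisors[OF assms(7)] unfolding S_def by blast
  then obtain \<epsilon> where fin: "finite S" and \<epsilon>: "\<epsilon> \<in> Units (Z_adj \<zeta>)"
    and \<alpha>: "\<alpha> = \<epsilon> * (\<Prod>\<pi>\<in>S. \<pi> ^ e \<pi>)" by (auto simp: prime_decomposition_def)
  have S_prime: "\<psi> \<in> prime_elements \<zeta>" if "\<psi> \<in> S" for \<psi> using that P_prime by (auto simp: S_def)
  have S_odd: "odd_element \<zeta> \<psi>" if "\<psi> \<in> S" for \<psi>
    using that \<alpha>_odd Z_adj_divides_trans[of \<zeta> "1 - \<zeta>" \<psi> \<alpha>] by (auto simp: odd_element_def S_def)

  \<comment> \<open>As geometric sums, the factors of \<open>sigma\<close> visibly lie in
    \<open>\<int>[\<zeta>]\<close>, which the quotients do not show.\<close>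
  define s where "s = (\<lambda>\<psi>::complex. \<Sum>i<e \<psi> + 1. \<psi> ^ i)"
  have sR: "s \<psi> \<in> carrier (Z_adj \<zeta>)" if "\<psi> \<in> S" for \<psi>
    unfolding s_def using prime_elementsD(1)[OF S_prime[OF that]] by auto
  have sigma: "sigma \<zeta> P \<alpha> = (\<Prod>\<psi>\<in>S. s \<psi>)"
    unfolding sigma_eq[OF dec] s_def
  proof (rule prod.cong)
    fix \<psi> assume "\<psi> \<in> S"
    hence "\<psi> \<noteq> 1" using prime_elementsD(4)[OF S_prime] by blast
    thus "(\<psi> ^ (e \<psi> + 1) - 1) / (\<psi> - 1) = (\<Sum>i<e \<psi> + 1. \<psi> ^ i)" by (rule geometric_sum[symmetric])
  qed simp
  have sigR: "(\<Prod>\<psi>\<in>S. s \<psi>) \<in> carrier (Z_adj \<zeta>)" using sR by auto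
  have N: "field_norm \<zeta> (\<Prod>\<psi>\<in>S. s \<psi>) = field_norm \<zeta> (1 - \<zeta>) * field_norm \<zeta> \<alpha>"
    using assms(9) by (simp add: norm_perfect_def sigma)
  note exact = one_minus_exactly_divides[OF sigR assms(7) N \<alpha>_odd]
  \<comment> \<open>The exceptional prime \<open>\<psi>\<^sub>0\<close> is the one whose factor of
    \<open>sigma\<close> takes up the single \<open>1 - \<zeta>\<close>.\<close>
  obtain \<psi>\<^sub>0 where \<psi>0: "\<psi>\<^sub>0 \<in> S" "(1 - \<zeta>) divides\<^bsub>Z_adj \<zeta>\<^esub> s \<psi>\<^sub>0"
    using prime_element_divides_prod[OF one_minus_prime sR exact(1)] by blast
  have others: "\<not> (1 - \<zeta>) divides\<^bsub>Z_adj \<zeta>\<^esub> s \<psi>" if \<psi>: "\<psi> \<in> S" "\<psi> \<noteq> \<psi>\<^sub>0" for \<psi>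
  proof
    assume "(1 - \<zeta>) divides\<^bsub>Z_adj \<zeta>\<^esub> s \<psi>"
    then obtain a b where ab: "a \<in> carrier (Z_adj \<zeta>)" "s \<psi>\<^sub>0 = (1 - \<zeta>) * a"
      "b \<in> carrier (Z_adj \<zeta>)" "s \<psi> = (1 - \<zeta>) * b"
      using \<psi>0(2) by (auto simp: Z_adj_divides_iff)
    \<comment> \<open>Two divisible factors are pulled out of the product; together they would
      contribute the square of \<open>1 - \<zeta>\<close>.\<close>
    have "(\<Prod>\<psi>\<in>S. s \<psi>) = s \<psi>\<^sub>0 * (s \<psi> * (\<Prod>\<psi>\<in>S - {\<psi>\<^sub>0} - {\<psi>}. s \<psi>))"
      using \<psi> fin by (simp add: prod.remove[OF fin \<psi>0(1)] prod.remove[of "S - {\<psi>\<^sub>0}" \<psi>])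
    also have "\<dots> = (1 - \<zeta>) * (1 - \<zeta>) * (a * b * (\<Prod>\<psi>\<in>S - {\<psi>\<^sub>0} - {\<psi>}. s \<psi>))"
      by (simp add: ab(2,4) ac_simps)
    finally have "((1 - \<zeta>) * (1 - \<zeta>)) divides\<^bsub>Z_adj \<zeta>\<^esub> (\<Prod>\<psi>\<in>S. s \<psi>)"
      using ab(1,3) sR unfolding Z_adj_divides_iff by blast
    thus False using exact(2) by blast
  qed

  have Pj_iff: "\<psi> \<in> Pj j \<longleftrightarrow> \<psi> \<in> S \<and> (1 - \<zeta>) divides\<^bsub>Z_adj \<zeta>\<^esub> (\<psi> - of_nat j)" for \<psi> j
    by (auto simp: Pj_def prime_divisors_mod_def S_def)
  have cover: "\<exists>j\<in>{1..p-1}. \<psi> \<in> Pj j" if \<psi>: "\<psi> \<in> S" for \<psi>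
  proof -
    obtain j where j: "j < p" "(1 - \<zeta>) divides\<^bsub>Z_adj \<zeta>\<^esub> (\<psi> - of_nat j)"
      using residue_exists prime_elementsD(1)[OF S_prime[OF \<psi>]] by blast
    \<comment> \<open>Residue 0 would mean that \<open>1 - \<zeta>\<close> divides \<psi> and hence
      \<alpha>.\<close>
    moreover have "j \<noteq> 0" using j(2) S_odd[OF \<psi>] by (cases j) (auto simp: odd_element_def)
    ultimately show ?thesis using \<psi> by (intro bexI[of _ j]) (auto simp: Pj_iff)
  qed
  \<comment> \<open>Distinct residues differ by less than \<open>p\<close> in absolute value.
    Disjointness lets the product over \<open>S\<close> be split into the double product.\<close>
  have disj: "Pj i \<inter> Pj j = {}" if "i \<in> {1..p-1}" "j \<in> {1..p-1}" "i \<noteq> j" for i j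
  proof (rule ccontr)
    assume "Pj i \<inter> Pj j \<noteq> {}"
    then obtain \<psi> where "(1 - \<zeta>) divides\<^bsub>Z_adj \<zeta>\<^esub> (\<psi> - of_nat i)"
      "(1 - \<zeta>) divides\<^bsub>Z_adj \<zeta>\<^esub> (\<psi> - of_nat j)" by (auto simp: Pj_iff)
    from Z_adj_divides_diff[OF this(2,1)]
    have "(1 - \<zeta>) divides\<^bsub>Z_adj \<zeta>\<^esub> of_int (int i - int j)" by simp
    hence "int p dvd int i - int j" by (simp only: one_minus_divides_of_int_iff)
    thus False using that dvd_imp_le_int[of "int i - int j" "int p"] by auto
  qed
  have Sdiff: "S - {\<psi>\<^sub>0} = (\<Union>j\<in>{1..p-1}. Pj j - {\<psi>\<^sub>0})" using cover by (auto simp: Pj_iff)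
  have Pj_fin: "finite (Pj j)" for j by (rule finite_subset[OF _ fin]) (auto simp: Pj_iff)
  have "(\<Prod>\<psi>\<in>S - {\<psi>\<^sub>0}. \<psi> ^ e \<psi>) = (\<Prod>j=1..p-1. \<Prod>\<psi>\<in>Pj j - {\<psi>\<^sub>0}. \<psi> ^ e \<psi>)"
    unfolding Sdiff using disj Pj_fin by (intro prod.UNION_disjoint) blast+
  hence \<alpha>_prod: "\<alpha> = \<epsilon> * \<psi>\<^sub>0 ^ e \<psi>\<^sub>0 * (\<Prod>j=1..p-1. \<Prod>\<psi>\<in>Pj j - {\<psi>\<^sub>0}. \<psi> ^ e \<psi>)"
    by (simp add: \<alpha> prod.remove[OF fin \<psi>0(1)] mult.assoc)

  have crit: "(1 - \<zeta>) divides\<^bsub>Z_adj \<zeta>\<^esub> s \<psi> \<longleftrightarrow> p dvd (\<Sum>i<e \<psi> + 1. j ^ i)" if "\<psi> \<in> Pj j" for \<psi> j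
    unfolding s_def using that prime_elementsD(1)[OF S_prime]
    by (intro one_minus_divides_geometric_sum_iff) (auto simp: Pj_iff)
  \<comment> \<open>For \<open>j = 1\<close> every term of the integer sum is 1, so the sum is the
    number of terms \<open>e \<psi> + 1\<close>.\<close>
  have crit1: "(1 - \<zeta>) divides\<^bsub>Z_adj \<zeta>\<^esub> s \<psi> \<longleftrightarrow> [int (e \<psi>) = -1] (mod int p)" if "\<psi> \<in> Pj 1" for \<psi>
    using crit[OF that] by (simp add: cong_minus_one_iff)
  have critj: "(1 - \<zeta>) divides\<^bsub>Z_adj \<zeta>\<^esub> s \<psi> \<longleftrightarrow> [int (e \<psi>) = -1] (mod int (ord p j))"
    if "\<psi> \<in> Pj j" "j \<in> {1..p-1}" "j \<noteq> 1" for \<psi> j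
  proof -
    have "1 < j" "j < p" using that(2,3) by auto
    thus ?thesis
      using crit[OF that(1)] prime_dvd_geometric_sum_iff[OF assms(1), of j "e \<psi> + 1"]
      by (simp only: cong_minus_one_iff)
  qed
  show ?thesis
  \<comment> \<open>The witnesses stay schematic here and are fixed by the statements shown; in
    particular \<open>k\<close> becomes \<open>e \<psi>\<^sub>0\<close>.\<close>
  proof (intro exI conjI)
    show "\<psi>\<^sub>0 \<in> (\<Union>j\<in>{1..p-1}. Pj j)" using cover[OF \<psi>0(1)] by blast
    show "\<forall>j\<in>{1..p-1}. finite (Pj j) \<and> (\<forall>\<psi>\<in>Pj j. odd_element \<zeta> \<psi>)"
      using Pj_fin S_odd by (auto simp: Pj_iff)
    show "\<forall>j\<in>{1..p-1}. j \<noteq> 1 \<longrightarrow>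
       (\<forall>\<psi>\<in>Pj j - {\<psi>\<^sub>0}. \<not> [int (e \<psi>) = -1] (mod int (ord p j)))"
      using critj others Pj_iff by blast
    show "\<forall>\<psi>\<in>Pj 1 - {\<psi>\<^sub>0}. \<not> [int (e \<psi>) = -1] (mod int p)"
      using crit1 others Pj_iff by blast
    show "\<forall>j\<in>{1..p-1}. j \<noteq> 1 \<longrightarrow> \<psi>\<^sub>0 \<in> Pj j \<longrightarrow> [int (e \<psi>\<^sub>0) = -1] (mod int (ord p j))"
      using critj \<psi>0(2) by blast
    show "\<psi>\<^sub>0 \<in> Pj 1 \<longrightarrow> [int (e \<psi>\<^sub>0) = -1] (mod int p)"
      using crit1 \<psi>0(2) by blast
  qed (fact \<epsilon> \<alpha>_prod)+
qed

end
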